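(* Let $\psi:H\to H^d$ be a $d$-fold similarity of a Hilbert space $H$, let $\rho$ be the representation of the Cuntz algebra $O_d$ associated with $\psi$, and let $T_i=\rho(a_i)$, $1\le i\le d$, be the images of the generators of the Cuntz algebra. Then the Schur complements are given by \[S_i(M)=\left(T_i^*M^{-1}T_i\right)^{-1}\] for every $i$ and every invertible $M\in B(H)$ for which $S_i(M)$ is defined.
   Context: A $d$-fold similarity ($d\ge 2$) of an infinite-dimensional Hilbert space $H$ is an isomorphism of Hilbert spaces (surjective linear isometry) $\psi:H\to H^d$. The Cuntz algebra $O_d$ is the universal unital $C^*$-algebra generated by $a_1,\ldots,a_d$ with $a_k^*a_k=1$ and $\sum_k a_ka_k^*=1$. The representation associated with $\psi$ sends $a_k$ to $T_k$, where $T_k(\xi)=\psi^{-1}(0,\ldots,0,\xi,0,\ldots,0)$ ($\xi$ in the $k$th coordinate). Schur complements: for $M\in B(H)$, write $\psi M\psi^{-1}$ as a $d\times d$ operator matrix $(M_{jk})$, $M_{jk}\in B(H)$. For a fixed $i$, let $A=M_{ii}$, let $B=(M_{ik})_{k\ne i}$ be the $i$th row with the entry $M_{ii}$ deleted, $C=(M_{ji})_{j\ne i}$ the $i$th column with $M_{ii}$ deleted, and $D=(M_{jk})_{j,k\ne i}\in B(H^{d-1})$. The $i$th Schur complement $S_i(M)\in B(H)$ is defined when $D$ is invertible, and then $S_i(M)=A-BD^{-1}C$. *)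

theory Defs
  imports "HOL-Analysis.Analysis" "HOL-Algebra.Module"
begin

text \<open>
  Complex Hilbert spaces. The real inner product inherited from \<open>real_inner\<close> is the real part of
  the complex one, so norm, metric and topology are those of the library. The complex inner
  product \<open>cinner\<close> is conjugate-linear in its first argument.
\<close>

class complex_inner = real_inner +
  fixes scaleC :: "complex \<Rightarrow> 'a \<Rightarrow> 'a" (infixr \<open>*\<^sub>C\<close> 75)
    and cinner :: "'a \<Rightarrow> 'a \<Rightarrow> complex"
  assumes scaleR_scaleC: "scaleR r x = complex_of_real r *\<^sub>C x"
    and scaleC_add_right: "c *\<^sub>C (x + y) = c *\<^sub>C x + c *\<^sub>C y"
    and scaleC_add_left: "(b + c) *\<^sub>C x = b *\<^sub>C x + c *\<^sub>C x"
    and scaleC_scaleC: "b *\<^sub>C c *\<^sub>C x = (b * c) *\<^sub>C x"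
    and scaleC_one: "1 *\<^sub>C x = x"
    and cinner_commute: "cinner x y = cnj (cinner y x)"
    and cinner_add_right: "cinner x (y + z) = cinner x y + cinner x z"
    and cinner_scaleC_right: "cinner x (c *\<^sub>C y) = c * cinner x y"
    and inner_eq_Re_cinner: "inner x y = Re (cinner x y)"

class complex_hilbert_space = complex_inner + complete_space

global_interpretation complex_vector:
  Vector_Spaces.vector_space "scaleC :: complex \<Rightarrow> 'a \<Rightarrow> 'a::complex_inner"
  by unfold_locales (simp_all add: scaleC_add_right scaleC_add_left scaleC_scaleC scaleC_one)

text \<open>The Hilbert space $H^d$ is \<open>'h ^ 'd\<close> with \<open>d = CARD('d)\<close>.\<close>

instantiation vec :: (complex_inner, finite) complex_inner
begin

definition scaleC_vec :: "complex \<Rightarrow> 'a ^ 'b \<Rightarrow> 'a ^ 'b"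
  where "scaleC_vec c x = (\<chi> i. c *\<^sub>C (x $ i))"

definition cinner_vec :: "'a ^ 'b \<Rightarrow> 'a ^ 'b \<Rightarrow> complex"
  where "cinner_vec x y = (\<Sum>i\<in>UNIV. cinner (x $ i) (y $ i))"

instance
proof
  fix x y z :: "'a ^ 'b" and b c :: complex and r :: real
  show "r *\<^sub>R x = complex_of_real r *\<^sub>C x"
    by (simp add: vec_eq_iff scaleC_vec_def scaleR_scaleC)
  show "c *\<^sub>C (x + y) = c *\<^sub>C x + c *\<^sub>C y"
    by (simp add: vec_eq_iff scaleC_vec_def scaleC_add_right)
  show "(b + c) *\<^sub>C x = b *\<^sub>C x + c *\<^sub>C x"
    by (simp add: vec_eq_iff scaleC_vec_def scaleC_add_left)
  show "b *\<^sub>C c *\<^sub>C x = (b * c) *\<^sub>C x"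
    by (simp add: vec_eq_iff scaleC_vec_def scaleC_scaleC)
  show "1 *\<^sub>C x = x"
    by (simp add: vec_eq_iff scaleC_vec_def scaleC_one)
  show "cinner x y = cnj (cinner y x)"
    unfolding cinner_vec_def cnj_sum by (rule sum.cong[OF refl], rule cinner_commute)
  show "cinner x (y + z) = cinner x y + cinner x z"
    by (simp add: cinner_vec_def cinner_add_right sum.distrib)
  show "cinner x (c *\<^sub>C y) = c * cinner x y"
    by (simp add: cinner_vec_def scaleC_vec_def cinner_scaleC_right sum_distrib_left)
  show "inner x y = Re (cinner x y)"
    by (simp add: cinner_vec_def inner_vec_def inner_eq_Re_cinner)
qed

end

instance vec :: (complex_hilbert_space, finite) complex_hilbert_space ..


section \<open>Unital C*-algebras and the Cuntz algebra\<close>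

text \<open>
  C*-algebras are records with a carrier, so that the universal property of the Cuntz algebra can
  quantify over them.
\<close>

definition complex_field :: "complex ring"
  where "complex_field = \<lparr>carrier = UNIV, mult = (*), one = 1, zero = 0, add = (+)\<rparr>"

record 'a cstar = "(complex, 'a) module" +
  star :: "'a \<Rightarrow> 'a"
  cnorm :: "'a \<Rightarrow> real"

locale cstar_algebra =
  fixes A :: "('a, 'm) cstar_scheme" (structure)
  assumes ring: "ring A"
    and module: "Module.module complex_field A"
    and smult_mult_left: "\<lbrakk>x \<in> carrier A; y \<in> carrier A\<rbrakk> \<Longrightarrow> (c \<odot> x) \<otimes> y = c \<odot> (x \<otimes> y)"
    and smult_mult_right: "\<lbrakk>x \<in> carrier A; y \<in> carrier A\<rbrakk> \<Longrightarrow> x \<otimes> (c \<odot> y) = c \<odot> (x \<otimes> y)"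
    and star_closed: "x \<in> carrier A \<Longrightarrow> star A x \<in> carrier A"
    and star_star: "x \<in> carrier A \<Longrightarrow> star A (star A x) = x"
    and star_add: "\<lbrakk>x \<in> carrier A; y \<in> carrier A\<rbrakk> \<Longrightarrow> star A (x \<oplus> y) = star A x \<oplus> star A y"
    and star_smult: "x \<in> carrier A \<Longrightarrow> star A (c \<odot> x) = cnj c \<odot> star A x"
    and star_mult: "\<lbrakk>x \<in> carrier A; y \<in> carrier A\<rbrakk> \<Longrightarrow> star A (x \<otimes> y) = star A y \<otimes> star A x"
    and cnorm_nonneg: "x \<in> carrier A \<Longrightarrow> 0 \<le> cnorm A x"
    and cnorm_eq_0_iff: "x \<in> carrier A \<Longrightarrow> cnorm A x = 0 \<longleftrightarrow> x = \<zero>"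
    and cnorm_add: "\<lbrakk>x \<in> carrier A; y \<in> carrier A\<rbrakk> \<Longrightarrow> cnorm A (x \<oplus> y) \<le> cnorm A x + cnorm A y"
    and cnorm_smult: "x \<in> carrier A \<Longrightarrow> cnorm A (c \<odot> x) = cmod c * cnorm A x"
    and cnorm_mult: "\<lbrakk>x \<in> carrier A; y \<in> carrier A\<rbrakk> \<Longrightarrow> cnorm A (x \<otimes> y) \<le> cnorm A x * cnorm A y"
    and cstar_identity: "x \<in> carrier A \<Longrightarrow> cnorm A (star A x \<otimes> x) = (cnorm A x)\<^sup>2"
    and complete: "\<lbrakk>range \<sigma> \<subseteq> carrier A;
        \<forall>e>0. \<exists>N::nat. \<forall>m\<ge>N. \<forall>n\<ge>N. cnorm A (\<sigma> m \<ominus> \<sigma> n) < e\<rbrakk>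
      \<Longrightarrow> \<exists>x\<in>carrier A. (\<lambda>n. cnorm A (\<sigma> n \<ominus> x)) \<longlonglongrightarrow> 0"

text \<open>Unital *-homomorphisms; \<open>ring_hom\<close> includes preservation of the unit.\<close>

definition star_hom :: "('a, 'm) cstar_scheme \<Rightarrow> ('b, 'n) cstar_scheme \<Rightarrow> ('a \<Rightarrow> 'b) set"
  where "star_hom A B = {h \<in> ring_hom A B. \<forall>x\<in>carrier A.
    (\<forall>c. h (c \<odot>\<^bsub>A\<^esub> x) = c \<odot>\<^bsub>B\<^esub> h x) \<and> h (star A x) = star B (h x)}"

definition sub_cstar_algebra :: "'a set \<Rightarrow> ('a, 'm) cstar_scheme \<Rightarrow> bool"
  where "sub_cstar_algebra S A \<longleftrightarrow>
    S \<subseteq> carrier A \<and> \<one>\<^bsub>A\<^esub> \<in> S \<and>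
    (\<forall>x\<in>S. \<forall>y\<in>S. x \<oplus>\<^bsub>A\<^esub> y \<in> S \<and> x \<otimes>\<^bsub>A\<^esub> y \<in> S) \<and>
    (\<forall>x\<in>S. star A x \<in> S \<and> (\<forall>c. c \<odot>\<^bsub>A\<^esub> x \<in> S)) \<and>
    (\<forall>\<sigma>::nat \<Rightarrow> 'a. \<forall>x\<in>carrier A.
      range \<sigma> \<subseteq> S \<and> (\<lambda>n. cnorm A (\<sigma> n \<ominus>\<^bsub>A\<^esub> x)) \<longlonglongrightarrow> 0 \<longrightarrow> x \<in> S)"

definition cuntz_relations :: "('a, 'm) cstar_scheme \<Rightarrow> ('d::finite \<Rightarrow> 'a) \<Rightarrow> bool"
  where "cuntz_relations A a \<longleftrightarrow>
    range a \<subseteq> carrier A \<and>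
    (\<forall>k. star A (a k) \<otimes>\<^bsub>A\<^esub> a k = \<one>\<^bsub>A\<^esub>) \<and>
    (\<Oplus>\<^bsub>A\<^esub>k\<in>UNIV. a k \<otimes>\<^bsub>A\<^esub> star A (a k)) = \<one>\<^bsub>A\<^esub>"

text \<open>
  \<open>A\<close> with generators \<open>a\<close> is the Cuntz algebra $O_d$, \<open>d = CARD('d)\<close>. The target \<open>B\<close> in the
  universal property has its elements in the type \<open>real\<close>: this is no restriction, since the
  C*-subalgebra generated by the finite family \<open>b\<close> is separable, hence has at most the cardinality
  of the continuum. The homomorphism is unique because \<open>a\<close> generates \<open>A\<close>.
\<close>

definition cuntz_algebra :: "('a, 'm) cstar_scheme \<Rightarrow> ('d::finite \<Rightarrow> 'a) \<Rightarrow> bool"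
  where "cuntz_algebra A a \<longleftrightarrow>
    2 \<le> CARD('d) \<and> cstar_algebra A \<and> cuntz_relations A a \<and>
    (\<forall>S. sub_cstar_algebra S A \<and> range a \<subseteq> S \<longrightarrow> S = carrier A) \<and>
    (\<forall>(B::real cstar) b. cstar_algebra B \<and> cuntz_relations B b \<longrightarrow>
      (\<exists>h\<in>star_hom A B. \<forall>k. h (a k) = b k))"


section \<open>Bounded operators\<close>

text \<open>
  \<open>bounded_ops S\<close> is $B(S)$ for a closed complex subspace \<open>S\<close>; operators on \<open>S\<close> are functions
  taking the dummy value \<open>undefined\<close> outside \<open>S\<close>. The quotient in the operator norm is 0 at the
  zero vector.
\<close>

definition bounded_ops :: "'h::complex_hilbert_space set \<Rightarrow> ('h \<Rightarrow> 'h) cstar"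
  where "bounded_ops S =
   \<lparr>carrier = {f \<in> extensional S \<inter> (S \<rightarrow> S).
        (\<forall>x\<in>S. \<forall>y\<in>S. f (x + y) = f x + f y) \<and>
        (\<forall>c. \<forall>x\<in>S. f (c *\<^sub>C x) = c *\<^sub>C f x) \<and>
        (\<exists>K. \<forall>x\<in>S. norm (f x) \<le> K * norm x)},
    mult = compose S,
    one = (\<lambda>x\<in>S. x),
    zero = (\<lambda>x\<in>S. 0),
    add = (\<lambda>f g. \<lambda>x\<in>S. f x + g x),
    smult = (\<lambda>c f. \<lambda>x\<in>S. c *\<^sub>C f x),
    star = (\<lambda>f. \<lambda>y\<in>S. THE z. z \<in> S \<and> (\<forall>x\<in>S. cinner (f x) y = cinner x z)),
    cnorm = (\<lambda>f. SUP x\<in>S. norm (f x) / norm x)\<rparr>"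

abbreviation BH :: "('h::complex_hilbert_space \<Rightarrow> 'h) cstar"
  where "BH \<equiv> bounded_ops UNIV"


section \<open>Similarities and Schur complements\<close>

definition similarity :: "('h::complex_hilbert_space \<Rightarrow> 'h ^ 'd::finite) \<Rightarrow> bool"
  where "similarity \<psi> \<longleftrightarrow>
    2 \<le> CARD('d) \<and>
    \<not> (\<exists>F::'h set. finite F \<and> complex_vector.span F = UNIV) \<and>
    (\<forall>x y. \<psi> (x + y) = \<psi> x + \<psi> y) \<and> (\<forall>c x. \<psi> (c *\<^sub>C x) = c *\<^sub>C \<psi> x) \<and>
    (\<forall>x. norm (\<psi> x) = norm x) \<and> surj \<psi>"

text \<open>\<open>axis k \<xi>\<close> is the vector with \<open>\<xi>\<close> in the \<open>k\<close>th coordinate and zeros elsewhere.\<close>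

definition cuntz_isometry :: "('h::complex_hilbert_space \<Rightarrow> 'h ^ 'd::finite) \<Rightarrow> 'd \<Rightarrow> 'h \<Rightarrow> 'h"
  where "cuntz_isometry \<psi> k \<xi> = the_inv \<psi> (axis k \<xi>)"

definition associated_rep ::
    "('h::complex_hilbert_space \<Rightarrow> 'h ^ 'd::finite) \<Rightarrow> ('a, 'm) cstar_scheme \<Rightarrow> ('d \<Rightarrow> 'a) \<Rightarrow>
     ('a \<Rightarrow> 'h \<Rightarrow> 'h) \<Rightarrow> bool"
  where "associated_rep \<psi> A a \<rho> \<longleftrightarrow>
    \<rho> \<in> star_hom A BH \<and> (\<forall>k. \<rho> (a k) = cuntz_isometry \<psi> k)"

text \<open>The entry $M_{jk}$ of the operator matrix of $\psi M \psi^{-1}$.\<close>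

definition block ::
    "('h::complex_hilbert_space \<Rightarrow> 'h ^ 'd::finite) \<Rightarrow> ('h \<Rightarrow> 'h) \<Rightarrow> 'd \<Rightarrow> 'd \<Rightarrow> 'h \<Rightarrow> 'h"
  where "block \<psi> M j k \<xi> = \<psi> (M (the_inv \<psi> (axis k \<xi>))) $ j"

text \<open>
  The space $H^{d-1}$ of families indexed by \<open>k \<noteq> i\<close> is realised as the closed subspace of $H^d$
  of vectors whose \<open>i\<close>th coordinate is zero.
\<close>

definition punctured :: "'d::finite \<Rightarrow> ('h::complex_hilbert_space ^ 'd) set"
  where "punctured i = {v. v $ i = 0}"

definition row_block ::
    "('h::complex_hilbert_space \<Rightarrow> 'h ^ 'd::finite) \<Rightarrow> ('h \<Rightarrow> 'h) \<Rightarrow> 'd \<Rightarrow> 'h ^ 'd \<Rightarrow> 'h"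
  where "row_block \<psi> M i v = (\<Sum>k\<in>-{i}. block \<psi> M i k (v $ k))"

definition col_block ::
    "('h::complex_hilbert_space \<Rightarrow> 'h ^ 'd::finite) \<Rightarrow> ('h \<Rightarrow> 'h) \<Rightarrow> 'd \<Rightarrow> 'h \<Rightarrow> 'h ^ 'd"
  where "col_block \<psi> M i \<xi> = (\<chi> j. if j = i then 0 else block \<psi> M j i \<xi>)"

definition minor_block ::
    "('h::complex_hilbert_space \<Rightarrow> 'h ^ 'd::finite) \<Rightarrow> ('h \<Rightarrow> 'h) \<Rightarrow> 'd \<Rightarrow> 'h ^ 'd \<Rightarrow> 'h ^ 'd"
  where "minor_block \<psi> M i = (\<lambda>v\<in>punctured i.
    \<chi> j. if j = i then 0 else (\<Sum>k\<in>-{i}. block \<psi> M j k (v $ k)))"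

definition schur_defined ::
    "('h::complex_hilbert_space \<Rightarrow> 'h ^ 'd::finite) \<Rightarrow> 'd \<Rightarrow> ('h \<Rightarrow> 'h) \<Rightarrow> bool"
  where "schur_defined \<psi> i M \<longleftrightarrow> minor_block \<psi> M i \<in> Units (bounded_ops (punctured i))"

definition schur_complement ::
    "('h::complex_hilbert_space \<Rightarrow> 'h ^ 'd::finite) \<Rightarrow> 'd \<Rightarrow> ('h \<Rightarrow> 'h) \<Rightarrow> 'h \<Rightarrow> 'h"
  where "schur_complement \<psi> i M \<xi> =
    block \<psi> M i i \<xi> -
    row_block \<psi> M i ((inv\<^bsub>bounded_ops (punctured i)\<^esub> (minor_block \<psi> M i)) (col_block \<psi> M i \<xi>))"

end

theory Submission
  imports Defs
begin

text \<open>
  Conjugating by \<open>\<psi>\<close> turns \<open>T\<^sub>i\<close> into the inclusion of the \<open>i\<close>th coordinate of $H^d$ and its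
  adjoint into the \<open>i\<close>th coordinate projection, so $T_i^* M^{-1} T_i$ is the \<open>(i, i)\<close> entry
  of the inverse operator matrix. That this entry is inverse to $A - B D^{-1} C$ is block elimination
  for the system $A x + B w = \xi$, $C x + D w = 0$.
\<close>

section \<open>Bounded operators\<close>

lemma bounded_ops_sel:
  "f \<otimes>\<^bsub>bounded_ops S\<^esub> g = compose S f g"
  "\<one>\<^bsub>bounded_ops S\<^esub> = (\<lambda>x\<in>S. x)"
  by (simp_all add: bounded_ops_def)

lemma mem_bounded_ops_iff:
  "f \<in> carrier (bounded_ops S) \<longleftrightarrow> f \<in> extensional S \<and> f \<in> S \<rightarrow> S \<and>
    (\<forall>x\<in>S. \<forall>y\<in>S. f (x + y) = f x + f y) \<and> (\<forall>c. \<forall>x\<in>S. f (c *\<^sub>C x) = c *\<^sub>C f x) \<and>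
    (\<exists>K. \<forall>x\<in>S. norm (f x) \<le> K * norm x)"
  by (auto simp: bounded_ops_def)

text \<open>A nonnegative constant can multiply the estimate of an inner factor, as every bound on a
  composition below requires.\<close>

lemma bounded_ops_nonneg_bound:
  assumes "f \<in> carrier (bounded_ops S)"
  shows "\<exists>K\<ge>0. \<forall>x\<in>S. norm (f x) \<le> K * norm x"
proof -
  obtain K where "\<And>x. x \<in> S \<Longrightarrow> norm (f x) \<le> K * norm x"
    using assms unfolding mem_bounded_ops_iff by blast
  then have "norm (f x) \<le> max 0 K * norm x" if "x \<in> S" for x
    using that by (meson max.cobounded2 mult_right_mono norm_ge_zero order_trans)
  then show ?thesis by (intro exI[of _ "max 0 K"]) auto
qed

text \<open>This opens the algebra of \<open>Units\<close> and \<open>inv\<close> both for $B(H)$,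
  where \<open>M\<close> is inverted, and for $B(H^{d-1})$, where $D$ is inverted.\<close>

lemma monoid_bounded_ops:
  assumes S: "complex_vector.subspace S"
  shows "Group.monoid (bounded_ops S)"
proof
  fix f g assume f: "f \<in> carrier (bounded_ops S)" and g: "g \<in> carrier (bounded_ops S)"
  obtain K where K: "0 \<le> K" "\<And>x. x \<in> S \<Longrightarrow> norm (f x) \<le> K * norm x"
    using bounded_ops_nonneg_bound[OF f] by blast
  obtain L where L: "0 \<le> L" "\<And>x. x \<in> S \<Longrightarrow> norm (g x) \<le> L * norm x"
    using bounded_ops_nonneg_bound[OF g] by blast
  have gS: "g x \<in> S" if "x \<in> S" for x
    using g that by (auto simp: mem_bounded_ops_iff)
  have "norm (f (g x)) \<le> (K * L) * norm x" if "x \<in> S" for x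
    using K(2)[OF gS[OF that]] mult_left_mono[OF L(2)[OF that] K(1)] by (simp add: mult.assoc)
  then show "f \<otimes>\<^bsub>bounded_ops S\<^esub> g \<in> carrier (bounded_ops S)"
    using f g S by (auto simp: mem_bounded_ops_iff bounded_ops_sel compose_def Pi_iff
        complex_vector.subspace_add complex_vector.subspace_scale)
  fix h assume "h \<in> carrier (bounded_ops S)"
  then show "f \<otimes>\<^bsub>bounded_ops S\<^esub> g \<otimes>\<^bsub>bounded_ops S\<^esub> h =
      f \<otimes>\<^bsub>bounded_ops S\<^esub> (g \<otimes>\<^bsub>bounded_ops S\<^esub> h)"
    by (auto simp: bounded_ops_sel mem_bounded_ops_iff compose_def Pi_iff fun_eq_iff)
next
  show "\<one>\<^bsub>bounded_ops S\<^esub> \<in> carrier (bounded_ops S)"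
    using S by (auto simp: mem_bounded_ops_iff bounded_ops_sel complex_vector.subspace_add
        complex_vector.subspace_scale intro!: exI[of _ 1])
next
  fix f assume f: "f \<in> carrier (bounded_ops S)"
  show "\<one>\<^bsub>bounded_ops S\<^esub> \<otimes>\<^bsub>bounded_ops S\<^esub> f = f"
    using f by (auto simp: bounded_ops_sel mem_bounded_ops_iff compose_def Pi_iff fun_eq_iff
        extensional_def)
  show "f \<otimes>\<^bsub>bounded_ops S\<^esub> \<one>\<^bsub>bounded_ops S\<^esub> = f"
    using f by (auto simp: bounded_ops_sel mem_bounded_ops_iff compose_def fun_eq_iff
        extensional_def)
qed

text \<open>On the whole space extensionality is vacuous, so membership reduces to real bounded
  linearity, which the library can compose, together with complex homogeneity.\<close>

lemma mem_BH_iff: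
  "f \<in> carrier BH \<longleftrightarrow> bounded_linear f \<and> (\<forall>c x. f (c *\<^sub>C x) = c *\<^sub>C f x)"
proof
  assume f: "f \<in> carrier BH"
  obtain K where "\<And>x. norm (f x) \<le> K * norm x"
    using bounded_ops_nonneg_bound[OF f] by blast
  with f show "bounded_linear f \<and> (\<forall>c x. f (c *\<^sub>C x) = c *\<^sub>C f x)"
    by (auto simp: mem_bounded_ops_iff scaleR_scaleC mult.commute
        intro!: bounded_linear_intro[where K = K])
next
  assume "bounded_linear f \<and> (\<forall>c x. f (c *\<^sub>C x) = c *\<^sub>C f x)"
  then show "f \<in> carrier BH"
    using bounded_linear.bounded[of f]
    by (auto simp: mem_bounded_ops_iff linear_add[OF bounded_linear.linear] mult.commute)
qed

lemma BH_mult: "f \<otimes>\<^bsub>BH\<^esub> g = f \<circ> g"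
  by (simp add: bounded_ops_sel compose_def fun_eq_iff)

lemma BH_one: "\<one>\<^bsub>BH\<^esub> = id"
  by (simp add: bounded_ops_sel fun_eq_iff)

lemma monoid_BH: "Group.monoid BH"
  by (rule monoid_bounded_ops) simp

text \<open>Turns the inverse laws into pointwise equations. They are confined to \<open>S\<close>
  because products and the unit take the value \<open>undefined\<close> elsewhere.\<close>

lemma Units_bounded_ops_inv:
  assumes "complex_vector.subspace S" "f \<in> Units (bounded_ops S)"
  shows "inv\<^bsub>bounded_ops S\<^esub> f \<in> carrier (bounded_ops S)"
    and "x \<in> S \<Longrightarrow> f ((inv\<^bsub>bounded_ops S\<^esub> f) x) = x"
    and "x \<in> S \<Longrightarrow> (inv\<^bsub>bounded_ops S\<^esub> f) (f x) = x"
proof -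
  interpret Group.monoid "bounded_ops S"
    using assms(1) by (rule monoid_bounded_ops)
  show "inv\<^bsub>bounded_ops S\<^esub> f \<in> carrier (bounded_ops S)"
    using assms(2) by simp
  show "f ((inv\<^bsub>bounded_ops S\<^esub> f) x) = x" if "x \<in> S"
    using fun_cong[OF Units_r_inv[OF assms(2)], of x] that by (simp add: bounded_ops_sel compose_def)
  show "(inv\<^bsub>bounded_ops S\<^esub> f) (f x) = x" if "x \<in> S"
    using fun_cong[OF Units_l_inv[OF assms(2)], of x] that by (simp add: bounded_ops_sel compose_def)
qed

section \<open>Adjoints, isometries and coordinates in $H^d$\<close>

lemma BH_star_eqI:
  fixes f g :: "'h::complex_hilbert_space \<Rightarrow> 'h"
  assumes "\<And>x y. cinner (f x) y = cinner x (g y)"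
  shows "star BH f = g"
proof
  fix y
  have "(THE z. \<forall>x. cinner (f x) y = cinner x z) = g y"
  proof (rule the_equality)
    fix z assume "\<forall>x. cinner (f x) y = cinner x z"
    then have "cinner x z = cinner x (g y)" for x
      using assms by metis
    then have "inner x z = inner x (g y)" for x
      by (simp add: inner_eq_Re_cinner)
    then have "inner (z - g y) (z - g y) = 0"
      by (simp add: inner_diff_right)
    then show "z = g y" by simp
  qed (use assms in auto)
  then show "star BH f y = g y"
    by (simp add: bounded_ops_def)
qed

text \<open>Polarization recovers the real inner product from the norm. The imaginary part of the
  complex one is, up to sign, the real inner product with $iy$, and \<open>f\<close> commutes with
  multiplication by $i$.\<close>

lemma cinner_isometry:
  fixes f :: "'a::complex_inner \<Rightarrow> 'b::complex_inner"
  assumes add: "\<And>x y. f (x + y) = f x + f y" and scale: "\<And>c x. f (c *\<^sub>C x) = c *\<^sub>C f x"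
    and norm: "\<And>x. norm (f x) = norm x"
  shows "cinner (f x) (f y) = cinner x y"
proof -
  have inner: "inner (f x) (f y) = inner x y" for x y
    by (simp add: dot_norm norm flip: add)
  have Im: "Im (cinner u v) = - inner u (\<i> *\<^sub>C v)" for u v :: "'c::complex_inner"
    by (simp add: inner_eq_Re_cinner cinner_scaleC_right)
  show ?thesis
    using inner[of x y] inner[of x "\<i> *\<^sub>C y"]
    by (simp add: complex_eq_iff Im inner_eq_Re_cinner[symmetric] scale)
qed

lemma scaleC_zero_right [simp]: "c *\<^sub>C (0::'a::complex_inner) = 0"
  by (rule complex_vector.scale_zero_right)

lemma scaleC_nth [simp]: "(c *\<^sub>C v) $ j = c *\<^sub>C (v $ j)"
  by (simp add: scaleC_vec_def)

lemma cinner_axis_left: "cinner (axis i x) v = cinner x (v $ i)"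
proof -
  have "cinner 0 y = 0" for y :: 'a
    using cinner_add_right[of y 0 0] cinner_commute[of 0 y] by simp
  then have "(\<Sum>k\<in>UNIV. cinner (axis i x $ k) (v $ k)) =
      (\<Sum>k\<in>UNIV. if k = i then cinner x (v $ k) else 0)"
    by (intro sum.cong) (auto simp: axis_def)
  then show ?thesis
    by (simp add: cinner_vec_def)
qed

lemma axis_scaleC: "axis i (c *\<^sub>C x) = c *\<^sub>C axis i (x::'a::complex_inner)"
  by (auto simp: vec_eq_iff axis_def)

lemma bounded_linear_axis: "bounded_linear (axis k :: 'a::real_normed_vector \<Rightarrow> 'a ^ 'd::finite)"
proof (rule bounded_linear_intro[where K = 1])
  fix x y :: 'a and r :: real
  show "axis k (x + y) = (axis k x + axis k y :: 'a ^ 'd)" "axis k (r *\<^sub>R x) = (r *\<^sub>R axis k x :: 'a ^ 'd)"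
    by (auto simp: vec_eq_iff axis_def)
  have "norm ((axis k x :: 'a ^ 'd) $ j) = (if j = k then norm x else 0)" for j
    by (simp add: axis_def)
  then show "norm (axis k x :: 'a ^ 'd) \<le> norm x * 1"
    by (simp add: norm_vec_def L2_set_def if_distrib[of "\<lambda>t. t\<^sup>2"] cong: if_cong)
qed

text \<open>This decomposition is what expands a linear map on $H^d$ into its matrix
  entries.\<close>

lemma vec_eq_sum_axis: "v = (\<Sum>k\<in>UNIV. axis k (v $ k))"
proof -
  have "(\<Sum>k\<in>UNIV. axis k (v $ k) $ j) = (\<Sum>k\<in>UNIV. if k = j then v $ k else 0)" for j
    by (intro sum.cong) (auto simp: axis_def)
  then show ?thesis
    by (simp add: vec_eq_iff)
qed

lemma subspace_punctured: "complex_vector.subspace (punctured i)"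
  by (auto simp: complex_vector.subspace_def punctured_def)


section \<open>Operator matrices\<close>

locale similarity_map =
  fixes \<psi> :: "'h::complex_hilbert_space \<Rightarrow> 'h ^ 'd::finite"
  assumes similarity: "similarity \<psi>"
begin

lemma add: "\<psi> (x + y) = \<psi> x + \<psi> y"
  and scaleC: "\<psi> (c *\<^sub>C x) = c *\<^sub>C \<psi> x"
  and norm [simp]: "norm (\<psi> x) = norm x"
  and surj: "surj \<psi>"
  using similarity by (auto simp: similarity_def)

lemma bounded_linear: "bounded_linear \<psi>"
  by (rule bounded_linear_intro[where K = 1]) (simp_all add: add scaleC scaleR_scaleC)

lemma inj: "inj \<psi>"
proof (rule injI)
  fix x y assume "\<psi> x = \<psi> y"
  then have "norm (x - y) = 0"
    using norm[of "x - y"] by (simp add: linear_diff[OF bounded_linear.linear[OF bounded_linear]])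
  then show "x = y" by simp
qed

lemma psi_inv [simp]: "\<psi> (the_inv \<psi> v) = v"
  using f_the_inv_into_f[OF inj, of v] surj by simp

lemma inv_psi [simp]: "the_inv \<psi> (\<psi> x) = x"
  by (rule the_inv_f_f[OF inj])

lemma inv_scaleC: "the_inv \<psi> (c *\<^sub>C v) = c *\<^sub>C the_inv \<psi> v"
  by (metis psi_inv inv_psi scaleC)

lemma bounded_linear_inv: "bounded_linear (the_inv \<psi>)"
proof (rule bounded_linear_intro[where K = 1])
  show "the_inv \<psi> (u + v) = the_inv \<psi> u + the_inv \<psi> v" for u v
    by (metis psi_inv inv_psi add)
  show "norm (the_inv \<psi> v) \<le> norm v * 1" for v
    using norm[of "the_inv \<psi> v"] by simp
qed (simp add: inv_scaleC scaleR_scaleC)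

lemma cuntz_isometry_mem_BH: "cuntz_isometry \<psi> i \<in> carrier BH"
  unfolding mem_BH_iff cuntz_isometry_def
  by (auto simp: axis_scaleC inv_scaleC
      intro: bounded_linear_compose[OF bounded_linear_inv bounded_linear_axis])

text \<open>Since \<open>\<psi>\<close> preserves inner products, pairing $T_i x$ with $y$ is
  pairing \<open>axis i x\<close> with \<open>\<psi> y\<close>, and only the \<open>i\<close>th
  coordinate of \<open>\<psi> y\<close> survives.\<close>

lemma star_cuntz_isometry: "star BH (cuntz_isometry \<psi> i) = (\<lambda>y. \<psi> y $ i)"
proof (rule BH_star_eqI)
  fix x y
  have "cinner (cuntz_isometry \<psi> i x) y = cinner (\<psi> (cuntz_isometry \<psi> i x)) (\<psi> y)"
    by (simp add: cinner_isometry[of \<psi>] add scaleC)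
  then show "cinner (cuntz_isometry \<psi> i x) y = cinner x (\<psi> y $ i)"
    by (simp add: cuntz_isometry_def cinner_axis_left)
qed

lemma star_cuntz_isometry_mem_BH: "star BH (cuntz_isometry \<psi> i) \<in> carrier BH"
  unfolding star_cuntz_isometry mem_BH_iff
  by (auto simp: scaleC intro: bounded_linear_compose[OF bounded_linear_vec_nth bounded_linear])

lemma matrix_action:
  assumes "M \<in> carrier BH"
  shows "\<psi> (M (the_inv \<psi> v)) $ j = (\<Sum>k\<in>UNIV. block \<psi> M j k (v $ k))"
proof -
  have lin: "linear (\<lambda>v. \<psi> (M (the_inv \<psi> v)) $ j)"
    using assms unfolding mem_BH_iff
    by (intro bounded_linear.linear bounded_linear_compose[OF bounded_linear_vec_nth]
        bounded_linear_compose[OF bounded_linear] bounded_linear_compose[OF _ bounded_linear_inv]) simp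
  show ?thesis
    by (subst vec_eq_sum_axis[of v]) (simp add: linear_sum[OF lin] block_def)
qed

text \<open>Separating column \<open>i\<close> puts each row in the two-block form used for
  elimination: row \<open>i\<close> reads $A, B$ and the other rows read $C, D$.\<close>

lemma matrix_action_split:
  assumes "M \<in> carrier BH"
  shows "\<psi> (M (the_inv \<psi> v)) $ j = block \<psi> M j i (v $ i) + (\<Sum>k\<in>-{i}. block \<psi> M j k (v $ k))"
  by (simp add: matrix_action[OF assms] sum.remove[of UNIV i] Compl_eq_Diff_UNIV)

lemma bounded_linear_block:
  assumes "M \<in> carrier BH"
  shows "bounded_linear (block \<psi> M j k)"
proof -
  have M: "bounded_linear M"
    using assms by (simp add: mem_BH_iff)
  show ?thesis
    unfolding block_def
    by (intro bounded_linear_compose[OF bounded_linear_vec_nth]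
      bounded_linear_compose[OF bounded_linear] bounded_linear_compose[OF M]
      bounded_linear_compose[OF bounded_linear_inv] bounded_linear_axis)
qed

lemma bounded_linear_row_block:
  assumes "M \<in> carrier BH"
  shows "bounded_linear (row_block \<psi> M i)"
  unfolding row_block_def
  by (intro bounded_linear_sum bounded_linear_compose[OF bounded_linear_block[OF assms]]
      bounded_linear_vec_nth)

lemma bounded_linear_col_block:
  assumes "M \<in> carrier BH"
  shows "bounded_linear (col_block \<psi> M i)"
proof -
  \<comment> \<open>As a finite sum of coordinate inclusions applied to entries, the column inherits
    boundedness from its entries.\<close>
  have "col_block \<psi> M i = (\<lambda>\<xi>. \<Sum>j\<in>-{i}. axis j (block \<psi> M j i \<xi>))"
  proof (rule ext)
    fix \<xi>
    have "(\<Sum>j\<in>-{i}. axis j (block \<psi> M j i \<xi>) $ m) =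
        (\<Sum>j\<in>-{i}. if j = m then block \<psi> M j i \<xi> else 0)" for m
      by (intro sum.cong) (auto simp: axis_def)
    then show "col_block \<psi> M i \<xi> = (\<Sum>j\<in>-{i}. axis j (block \<psi> M j i \<xi>))"
      by (simp add: vec_eq_iff col_block_def)
  qed
  moreover have "bounded_linear (\<lambda>\<xi>. \<Sum>j\<in>-{i}. axis j (block \<psi> M j i \<xi>) :: 'h ^ 'd)"
    by (rule bounded_linear_sum)
      (rule bounded_linear_compose[OF bounded_linear_axis bounded_linear_block[OF assms]])
  ultimately show ?thesis by simp
qed

lemma col_block_mem: "col_block \<psi> M i \<xi> \<in> punctured i"
  by (simp add: col_block_def punctured_def)

text \<open>The estimate is assembled by hand because $D^{-1}$ lives on \<open>punctured i\<close>
  and takes a dummy value outside it, so it need not be linear on all of $H^d$. Linearity of the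
  Schur complement is obtained later, from its being an inverse.\<close>

lemma schur_complement_bounded:
  assumes M: "M \<in> carrier BH" and D: "schur_defined \<psi> i M"
  obtains K where "\<And>x. norm (schur_complement \<psi> i M x) \<le> norm x * K"
proof -
  let ?E = "inv\<^bsub>bounded_ops (punctured i)\<^esub> (minor_block \<psi> M i)"
  have E: "?E \<in> carrier (bounded_ops (punctured i))"
    using Units_bounded_ops_inv(1)[OF subspace_punctured] D by (simp add: schur_defined_def)
  obtain K where K: "0 \<le> K" "\<And>v. v \<in> punctured i \<Longrightarrow> norm (?E v) \<le> K * norm v"
    using bounded_ops_nonneg_bound[OF E] by blast
  obtain KA where KA: "\<And>x. norm (block \<psi> M i i x) \<le> norm x * KA"
    using bounded_linear.bounded[OF bounded_linear_block[OF M]] by blast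
  obtain KB where KB: "0 \<le> KB" "\<And>v. norm (row_block \<psi> M i v) \<le> norm v * KB"
    using bounded_linear.nonneg_bounded[OF bounded_linear_row_block[OF M]] by blast
  obtain KC where KC: "\<And>x. norm (col_block \<psi> M i x) \<le> norm x * KC"
    using bounded_linear.bounded[OF bounded_linear_col_block[OF M]] by blast
  have "norm (schur_complement \<psi> i M x) \<le> norm x * (KA + K * KC * KB)" for x
  proof -
    have "norm (?E (col_block \<psi> M i x)) \<le> K * (norm x * KC)"
      using K(2)[OF col_block_mem] mult_left_mono[OF KC K(1)] order_trans by blast
    then have "norm (row_block \<psi> M i (?E (col_block \<psi> M i x))) \<le> K * (norm x * KC) * KB"
      using KB by (meson mult_right_mono order_trans)
    then show ?thesis
      using KA[of x] norm_triangle_ineq4[of "block \<psi> M i i x" "row_block \<psi> M i (?E (col_block \<psi> M i x))"]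
      unfolding schur_complement_def by (simp add: algebra_simps)
  qed
  then show ?thesis using that by blast
qed

section \<open>Block elimination: compression and Schur complement are mutually inverse\<close>

context
  fixes M i
  assumes M: "M \<in> Units BH" and D: "schur_defined \<psi> i M"
begin

private abbreviation "P \<equiv> inv\<^bsub>BH\<^esub> M"
private abbreviation "E \<equiv> inv\<^bsub>bounded_ops (punctured i)\<^esub> (minor_block \<psi> M i)"
private abbreviation "X \<equiv> star BH (cuntz_isometry \<psi> i) \<otimes>\<^bsub>BH\<^esub> P \<otimes>\<^bsub>BH\<^esub> cuntz_isometry \<psi> i"

private lemma M_mem: "M \<in> carrier BH"
  using M by (simp add: Units_def)

private lemma P: "P \<in> carrier BH" "M (P x) = x" "P (M x) = x"
  using Units_bounded_ops_inv[OF complex_vector.subspace_UNIV M] by auto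

private lemma E: "E \<in> carrier (bounded_ops (punctured i))"
  "v \<in> punctured i \<Longrightarrow> minor_block \<psi> M i (E v) = v"
  "v \<in> punctured i \<Longrightarrow> E (minor_block \<psi> M i v) = v"
  using Units_bounded_ops_inv[OF subspace_punctured, where f = "minor_block \<psi> M i"] D
  by (auto simp: schur_defined_def)

private lemma X_apply: "X \<xi> = \<psi> (P (the_inv \<psi> (axis i \<xi>))) $ i"
  by (simp add: BH_mult star_cuntz_isometry cuntz_isometry_def)

private lemma X_mem: "X \<in> carrier BH"
proof -
  interpret Group.monoid "BH :: ('h \<Rightarrow> 'h) cstar" by (rule monoid_BH)
  show ?thesis
    by (intro m_closed star_cuntz_isometry_mem_BH cuntz_isometry_mem_BH P)
qed

lemma schur_complement_compression: "schur_complement \<psi> i M (X \<xi>) = \<xi>"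
proof -
  define v where "v = \<psi> (P (the_inv \<psi> (axis i \<xi>)))"
  \<comment> \<open>The sign is chosen so that $Dw = C v_i$, whence \<open>E\<close> recovers
    \<open>w\<close> from the column.\<close>
  define w where "w = (\<chi> k. if k = i then 0 else - (v $ k))"
  have w: "w \<in> punctured i"
    by (simp add: w_def punctured_def)
  have neg: "block \<psi> M j k (- x) = - block \<psi> M j k x" for j k x
    using bounded_linear_block[OF M_mem] by (simp add: linear_neg bounded_linear.linear)
  have sum_w: "(\<Sum>k\<in>-{i}. block \<psi> M j k (w $ k)) = - (\<Sum>k\<in>-{i}. block \<psi> M j k (v $ k))" for j
    by (simp add: w_def neg sum_negf)
  have eq: "axis i \<xi> $ j = block \<psi> M j i (v $ i) + (\<Sum>k\<in>-{i}. block \<psi> M j k (v $ k))" for j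
    using matrix_action_split[OF M_mem, of v j i] by (simp add: v_def P)
  \<comment> \<open>For \<open>j\<close> different from \<open>i\<close> the left side of
    \<open>eq\<close> vanishes; for \<open>j = i\<close> both sides here are 0 by
    convention.\<close>
  have "col_block \<psi> M i (v $ i) $ j = minor_block \<psi> M i w $ j" for j
    using w eq[of j] by (auto simp: col_block_def minor_block_def sum_w axis_def add_eq_0_iff2)
  then have "E (col_block \<psi> M i (v $ i)) = w"
    using E(3)[OF w] by (metis vec_eq_iff)
  then show ?thesis
    using eq[of i] unfolding schur_complement_def X_apply row_block_def v_def[symmetric]
    by (simp add: sum_w axis_def)
qed

lemma compression_schur_complement: "X (schur_complement \<psi> i M \<xi>) = \<xi>"
proof -
  define w where "w = E (col_block \<psi> M i \<xi>)"
  define v where "v = (\<chi> k. if k = i then \<xi> else - (w $ k))"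
  \<comment> \<open>Needed to unfold \<open>minor_block\<close> at \<open>w\<close>, where it then
    has its genuine value rather than \<open>undefined\<close>.\<close>
  have w: "w \<in> punctured i"
    using E(1) col_block_mem unfolding w_def by (auto simp: mem_bounded_ops_iff Pi_iff)
  have neg: "block \<psi> M j k (- x) = - block \<psi> M j k x" for j k x
    using bounded_linear_block[OF M_mem] by (simp add: linear_neg bounded_linear.linear)
  have sum_v: "(\<Sum>k\<in>-{i}. block \<psi> M j k (v $ k)) = - (\<Sum>k\<in>-{i}. block \<psi> M j k (w $ k))" for j
    by (simp add: v_def neg sum_negf)
  have vi: "v $ i = \<xi>"
    by (simp add: v_def)
  have "minor_block \<psi> M i w = col_block \<psi> M i \<xi>"
    unfolding w_def by (rule E(2)[OF col_block_mem])
  then have Dw: "block \<psi> M j i \<xi> = (\<Sum>k\<in>-{i}. block \<psi> M j k (w $ k))" if "j \<noteq> i" for j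
    using w that by (auto simp: minor_block_def col_block_def vec_eq_iff dest: spec[of _ j])
  have "\<psi> (M (the_inv \<psi> v)) $ j = axis i (schur_complement \<psi> i M \<xi>) $ j" for j
    using Dw[of j] unfolding matrix_action_split[OF M_mem, of v j i] sum_v vi
    by (auto simp: axis_def schur_complement_def row_block_def w_def)
  then have "\<psi> (M (the_inv \<psi> v)) = axis i (schur_complement \<psi> i M \<xi>)"
    by (simp add: vec_eq_iff)
  then show ?thesis
    unfolding X_apply by (metis P(3) inv_psi psi_inv vi)
qed

text \<open>Additivity and homogeneity pass from \<open>X\<close> to its two-sided inverse;
  continuity comes from the explicit bound.\<close>

private lemma schur_complement_mem: "schur_complement \<psi> i M \<in> carrier BH"
proof -
  have X: "linear X" "\<And>c x. X (c *\<^sub>C x) = c *\<^sub>C X x"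
    using X_mem by (auto simp: mem_BH_iff bounded_linear.linear)
  \<comment> \<open>To evaluate the Schur complement at \<open>x\<close> it suffices to exhibit a
    preimage of \<open>x\<close> under \<open>X\<close>.\<close>
  have inverse: "schur_complement \<psi> i M x = y" if "x = X y" for x y
    using that schur_complement_compression by simp
  have scale: "schur_complement \<psi> i M (c *\<^sub>C x) = c *\<^sub>C schur_complement \<psi> i M x" for c x
    by (rule inverse) (simp only: X(2) compression_schur_complement)
  obtain K where K: "\<And>x. norm (schur_complement \<psi> i M x) \<le> norm x * K"
    using schur_complement_bounded[OF M_mem D] by blast
  have "bounded_linear (schur_complement \<psi> i M)"
  proof (rule bounded_linear_intro[OF _ _ K])
    show "schur_complement \<psi> i M (x + y) = schur_complement \<psi> i M x + schur_complement \<psi> i M y"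
      for x y
      by (rule inverse) (simp only: linear_add[OF X(1)] compression_schur_complement)
  qed (simp add: scaleR_scaleC scale)
  then show ?thesis
    using scale by (simp add: mem_BH_iff)
qed

text \<open>Invertibility is recorded beside the formula because \<open>inv\<close> is a definite
  description, meaningful only on units. Uniqueness of inverses in the monoid then identifies the
  Schur complement.\<close>

lemma compression_Units: "X \<in> Units BH"
  and schur_complement_eq_inv: "schur_complement \<psi> i M = inv\<^bsub>BH\<^esub> X"
proof -
  have "X \<otimes>\<^bsub>BH\<^esub> schur_complement \<psi> i M = \<one>\<^bsub>BH\<^esub>"
    using compression_schur_complement by (simp add: BH_mult BH_one fun_eq_iff)
  moreover have "schur_complement \<psi> i M \<otimes>\<^bsub>BH\<^esub> X = \<one>\<^bsub>BH\<^esub>"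
    using schur_complement_compression by (simp add: BH_mult BH_one fun_eq_iff)
  ultimately show "X \<in> Units BH" "schur_complement \<psi> i M = inv\<^bsub>BH\<^esub> X"
    using X_mem schur_complement_mem monoid.inv_unique'[OF monoid_BH, of X "schur_complement \<psi> i M"]
    by (auto simp: Units_def)
qed

end

end

theorem proposition5p3:
  fixes \<psi> :: "'h::complex_hilbert_space \<Rightarrow> 'h ^ 'd::finite"
    and O\<^sub>d :: "'o cstar"
    and a :: "'d \<Rightarrow> 'o"
    and \<rho> :: "'o \<Rightarrow> 'h \<Rightarrow> 'h"
    and T :: "'d \<Rightarrow> 'h \<Rightarrow> 'h"
  assumes "similarity \<psi>"
    and "cuntz_algebra O\<^sub>d a"
    and "associated_rep \<psi> O\<^sub>d a \<rho>"
    and "\<And>i. T i = \<rho> (a i)"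
  shows "\<forall>i. \<forall>M\<in>Units BH. schur_defined \<psi> i M \<longrightarrow>
    star BH (T i) \<otimes>\<^bsub>BH\<^esub> inv\<^bsub>BH\<^esub> M \<otimes>\<^bsub>BH\<^esub> T i \<in> Units BH \<and>
    schur_complement \<psi> i M = inv\<^bsub>BH\<^esub> (star BH (T i) \<otimes>\<^bsub>BH\<^esub> inv\<^bsub>BH\<^esub> M \<otimes>\<^bsub>BH\<^esub> T i)"
proof -
  interpret similarity_map \<psi>
    by standard (rule assms(1))
  have "T i = cuntz_isometry \<psi> i" for i
    using assms(3,4) by (simp add: associated_rep_def)
  then show ?thesis
    using compression_Units schur_complement_eq_inv by simp
qed

end
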